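(* Let $(\mathbf{W},\mathbf{w},\mathcal{F})$ be a fusion frame system for $\mathcal{H}$ where each element in $\mathcal{F}$ has norm equal to $1$, let $\mathbf{v}=\{v_i\}_{i=1}^m$ be a family of weights and let $r\in\{1,\ldots,\sum_{i=1}^m|L_i|\}$. Let $\mathcal{G}_{c}=\{\mathcal{G}_{c,i}\}_{i=1}^m$ with $\mathcal{G}_{c,i}=\frac{1}{w_iv_i}S_{\mathcal{F}}^{-1}\mathcal{F}_i=\{\frac{1}{w_iv_i}S_{\mathcal{F}}^{-1}f_i^l\}_{l\in L_i}$. Then: (1) $(S_{\mathcal{F}}^{-1}\mathbf{W},\mathbf{v},\mathcal{G}_c)$ is an $(r,2)$-loss optimal component preserving dual fusion frame system for $(\mathbf{W},\mathbf{w},\mathcal{F})$. (2) If $(\mathbf{V},\mathbf{v},\mathcal{G})$ is an $(r,2)$-loss optimal dual fusion frame system of $(\mathbf{W},\mathbf{w},\mathcal{F})$, then $T_{\mathbf{V},\mathbf{v}}C_{\mathcal{G}}=T_{S_{\mathcal{F}}^{-1}\mathbf{W},\mathbf{v}}C_{\mathcal{G}_c}$. (3) If $(\mathbf{V},\mathbf{v},\mathcal{G})$ is an $(r,2)$-loss optimal component preserving dual fusion frame system of $(\mathbf{W},\mathbf{w},\mathcal{F})$, then $\mathbf{V}=S_{\mathcal{F}}^{-1}\mathbf{W}$ and $\mathcal{G}=\mathcal{G}_c$.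
   Context: $\mathcal{H}$ is a finite-dimensional Hilbert space over $\mathbb{F}=\mathbb{R}$ or $\mathbb{C}$, $m\in\mathbb{N}$; $\|\cdot\|_F$ is the Frobenius norm. A finite family is a frame for a finite-dimensional Hilbert space if it spans it. Fusion frames: $(\mathbf{W},\mathbf{w})=\{(W_i,w_i)\}_{i=1}^m$, a family of subspaces of $\mathcal{H}$ with weights $w_i>0$, is a fusion frame for $\mathcal{H}$ if $\mathrm{span}\bigcup_iW_i=\mathcal{H}$; $T\mathbf{W}$ denotes $\{TW_i\}_i$. Put $\mathcal{W}=\bigoplus_{i=1}^m W_i$ (external direct sum, with inner product $\sum_i\langle f_i,g_i\rangle$); similarly $\mathcal{V}=\bigoplus_iV_i$. Let $T_{\mathbf{W},\mathbf{w}}:\mathcal{W}\to\mathcal{H}$, $T_{\mathbf{W},\mathbf{w}}(f_i)_i=\sum_iw_if_i$, with adjoint $T^*_{\mathbf{W},\mathbf{w}}f=(w_i\pi_{W_i}f)_i$, $\pi_{W_i}$ the orthogonal projection onto $W_i$. $M_{j,\mathbf{W}}:\mathcal{W}\to\mathcal{W}$ keeps the $j$-th component and replaces the others by $0$; similarly $M_{j,\mathbf{V}}$. A linear $Q:\mathcal{W}\to\mathcal{V}$ is component preserving if $QM_{j,\mathbf{W}}\mathcal{W}=M_{j,\mathbf{V}}\mathcal{V}$ for each $j$. A fusion frame $(\mathbf{V},\mathbf{v})$ is a $Q$-dual fusion frame of $(\mathbf{W},\mathbf{w})$ if $T_{\mathbf{V},\mathbf{v}}QT^*_{\mathbf{W},\mathbf{w}}=I_{\mathcal{H}}$.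 Fusion frame systems: $(\mathbf{W},\mathbf{w},\mathcal{F})$, with $(\mathbf{W},\mathbf{w})$ a fusion frame for $\mathcal{H}$, $\mathcal{F}=\{\mathcal{F}_i\}_{i=1}^m$ and $\mathcal{F}_i=\{f_i^l\}_{l\in L_i}$ a (finite) frame for $W_i$, is a fusion frame system for $\mathcal{H}$. The family $\mathcal{F}=\{f_i^l\}_{l\in L_i,\,1\le i\le m}$ is then a frame for $\mathcal{H}$, with (invertible) frame operator $S_{\mathcal{F}}f=\sum_{i=1}^m\sum_{l\in L_i}\langle f,f_i^l\rangle f_i^l$. Let $C_{\mathcal{F}}:\bigoplus_i\mathbb{F}^{|L_i|}\to\mathcal{W}$, $C_{\mathcal{F}}((x_i^l)_{l\in L_i})_i=(\sum_{l\in L_i}x_i^lf_i^l)_i$, with adjoint $C^*_{\mathcal{F}}(g_i)_i=((\langle g_i,f_i^l\rangle)_{l\in L_i})_i$. A fusion frame system $(\mathbf{V},\mathbf{v},\mathcal{G})$, where $\mathcal{G}_i=\{g_i^l\}_{l\in L_i}$ has the same index set as $\mathcal{F}_i$, is a dual fusion frame system of $(\mathbf{W},\mathbf{w},\mathcal{F})$ if $(\mathbf{V},\mathbf{v})$ is a $C_{\mathcal{G}}C^*_{\mathcal{F}}$-dual fusion frame of $(\mathbf{W},\mathbf{w})$; it is a component preserving dual fusion frame system if moreover $C_{\mathcal{G}}C^*_{\mathcal{F}}$ is component preserving. Loss optimality: for $\mathcal{J}=(J_1,\ldots,J_m)$ with $J_i\subseteq L_i$ let $|\mathcal{J}|=\sum_i|J_i|$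 and let $M_{\mathcal{J}}$ be the operator on $\bigoplus_i\mathbb{F}^{|L_i|}$ that keeps the coordinates $x_i^l$ with $l\in J_i$ and replaces all others by $0$. Let $\mathcal{P}_r=\{\mathcal{J}:|\mathcal{J}|=r\}$, and for a dual fusion frame system $(\mathbf{V},\mathbf{v},\mathcal{G})$ of $(\mathbf{W},\mathbf{w},\mathcal{F})$ put $e(r,(\mathbf{W},\mathbf{w},\mathcal{F}),(\mathbf{V},\mathbf{v},\mathcal{G}))=(\|T_{\mathbf{V},\mathbf{v}}C_{\mathcal{G}}M_{\mathcal{J}}C_{\mathcal{F}}^*T^*_{\mathbf{W},\mathbf{w}}\|_F)_{\mathcal{J}\in\mathcal{P}_r}$. With $\|\cdot\|_p$ the usual $p$-norm ($p\in\mathbb{N}\cup\{\infty\}$), define inductively: $e_1^{(p)}(\mathbf{W},\mathbf{w},\mathcal{F})$ is the infimum of $\|e(1,(\mathbf{W},\mathbf{w},\mathcal{F}),(\mathbf{V},\mathbf{v},\mathcal{G}))\|_p$ over all dual fusion frame systems $(\mathbf{V},\mathbf{v},\mathcal{G})$ of $(\mathbf{W},\mathbf{w},\mathcal{F})$ (with arbitrary $\mathbf{V},\mathbf{v},\mathcal{G}$), and $\mathcal{D}_1^{(p)}(\mathbf{W},\mathbf{w},\mathcal{F})$ is the set of those attaining it; for $r\ge2$, $e_r^{(p)}(\mathbf{W},\mathbf{w},\mathcal{F})$ is the infimum of $\|e(r,(\mathbf{W},\mathbf{w},\mathcal{F}),(\mathbf{V},\mathbf{v},\mathcal{G}))\|_p$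 over $\mathcal{D}_{r-1}^{(p)}(\mathbf{W},\mathbf{w},\mathcal{F})$, and $\mathcal{D}_r^{(p)}(\mathbf{W},\mathbf{w},\mathcal{F})$ is the set of elements of $\mathcal{D}_{r-1}^{(p)}(\mathbf{W},\mathbf{w},\mathcal{F})$ attaining it. The elements of $\mathcal{D}_r^{(p)}(\mathbf{W},\mathbf{w},\mathcal{F})$ are called $(r,p)$-loss optimal. *)

theory Defs
  imports Complex_Main "HOL-Library.FuncSet" "HOL-Library.Extended_Nat"
begin

section \<open>Scalars\<close>

text \<open>
  The field is the reals or the complex numbers. Both are instances of the following class, and
  up to isomorphism they are its only models: every \<open>x\<close> is a root of the real quadratic
  \<open>X^2 - (x + scnj x) X + x * scnj x\<close>, because a \<open>scnj\<close>-fixed \<open>y\<close> satisfies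
  \<open>y^2 = (norm y)^2\<close> and so is real.
\<close>

class real_or_complex = real_normed_field +
  fixes scnj :: "'a \<Rightarrow> 'a"
  assumes scnj_add: "scnj (x + y) = scnj x + scnj y"
    and scnj_mult: "scnj (x * y) = scnj x * scnj y"
    and scnj_scnj: "scnj (scnj x) = x"
    and mult_scnj: "x * scnj x = scaleR ((norm x)\<^sup>2) 1"

instantiation real :: real_or_complex
begin
definition scnj_real :: "real \<Rightarrow> real" where "scnj_real x = x"
instance by standard (simp_all add: scnj_real_def power2_eq_square)
end

instantiation complex :: real_or_complex
begin
definition scnj_complex :: "complex \<Rightarrow> complex" where "scnj_complex = cnj"
instance by standard (simp_all add: scnj_complex_def scaleR_conv_of_real complex_norm_square flip: of_real_power)
end

lemma scnj_0 [simp]: "scnj 0 = 0"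
  using scnj_add[of 0 0] by simp

lemma scnj_minus: "scnj (- x) = - scnj x"
  using scnj_add[of x "- x"] by (simp add: eq_neg_iff_add_eq_0 add.commute)

lemma scnj_eq_0_iff [simp]: "scnj x = 0 \<longleftrightarrow> x = 0"
  using scnj_0 scnj_scnj by metis

lemma scnj_1 [simp]: "scnj 1 = 1"
  using mult_scnj[of 1] by simp

lemma scnj_of_real [simp]: "scnj (of_real c) = of_real c"
proof (cases "c = 0")
  case False
  have "of_real c * scnj (of_real c) = of_real c * (of_real c :: 'a)"
    using mult_scnj[of "of_real c :: 'a"]
    by (simp add: scaleR_conv_of_real power2_eq_square flip: of_real_mult)
  with False show ?thesis by simp
qed simp

section \<open>Finite-dimensional Hilbert spaces\<close>

text \<open>The inner product is linear in its first argument. The carrier is the whole type \<open>'h\<close>.\<close>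

locale fd_hilbert = vector_space scale
  for scale :: "'k::real_or_complex \<Rightarrow> 'h::ab_group_add \<Rightarrow> 'h" +
  fixes ip :: "'h \<Rightarrow> 'h \<Rightarrow> 'k"
  assumes ip_add_left: "ip (x + y) z = ip x z + ip y z"
    and ip_scale_left: "ip (scale a x) y = a * ip x y"
    and ip_commute: "ip y x = scnj (ip x y)"
    and ip_pos: "x \<noteq> 0 \<Longrightarrow> \<exists>c>0. ip x x = of_real c"
    and finite_dim: "\<exists>B. finite B \<and> span B = UNIV"
begin

definition hnorm :: "'h \<Rightarrow> real"
  where "hnorm x = sqrt (norm (ip x x))"

definition proj :: "'h set \<Rightarrow> 'h \<Rightarrow> 'h"
  where "proj U f = (THE g. g \<in> U \<and> (\<forall>u\<in>U. ip (f - g) u = 0))"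

definition orthonormal :: "'h set \<Rightarrow> bool"
  where "orthonormal B \<longleftrightarrow> (\<forall>a\<in>B. \<forall>b\<in>B. ip a b = (if a = b then 1 else 0))"

definition orthonormal_basis :: "'h set \<Rightarrow> bool"
  where "orthonormal_basis B \<longleftrightarrow> finite B \<and> orthonormal B \<and> span B = UNIV"

definition frob :: "('h \<Rightarrow> 'h) \<Rightarrow> real"
  where "frob A = sqrt (\<Sum>b\<in>(SOME B. orthonormal_basis B). (hnorm (A b))\<^sup>2)"

lemma ip_0_left [simp]: "ip 0 x = 0"
  using ip_add_left[of 0 0] by simp

lemma ip_0_right [simp]: "ip x 0 = 0"
  by (metis ip_0_left ip_commute scnj_0)

lemma ip_add_right: "ip x (y + z) = ip x y + ip x z"
  by (metis ip_add_left ip_commute scnj_add)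

lemma ip_scale_right: "ip x (scale a y) = scnj a * ip x y"
  by (metis ip_scale_left ip_commute scnj_mult)

lemma ip_minus_left: "ip (- x) y = - ip x y"
  using ip_add_left[of x "- x" y] by (simp add: eq_neg_iff_add_eq_0 add.commute)

lemma ip_diff_left: "ip (x - y) z = ip x z - ip y z"
  using ip_add_left[of x "- y" z] by (simp add: ip_minus_left)

lemma ip_sum_left: "ip (\<Sum>a\<in>A. f a) y = (\<Sum>a\<in>A. ip (f a) y)"
  by (induction A rule: infinite_finite_induct) (simp_all add: ip_add_left)

lemma ip_sum_right: "ip y (\<Sum>a\<in>A. f a) = (\<Sum>a\<in>A. ip y (f a))"
  by (induction A rule: infinite_finite_induct) (simp_all add: ip_add_right)

lemma ip_eq_0_iff [simp]: "ip x x = 0 \<longleftrightarrow> x = 0"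
  using ip_pos[of x] by (cases "x = 0") auto

lemma ip_self: "ip x x = of_real ((hnorm x)\<^sup>2)"
  using ip_pos[of x] by (cases "x = 0") (auto simp: hnorm_def)

lemma ip_span_0:
  assumes "\<forall>b\<in>B. ip x b = 0" and "y \<in> span B"
  shows "ip x y = 0"
  using assms(2)
  by (induction rule: span_induct_alt) (use assms(1) in \<open>auto simp: ip_add_right ip_scale_right\<close>)

lemma subspace_finite_span:
  assumes "subspace U"
  shows "\<exists>B. finite B \<and> span B = U"
proof -
  obtain S where S: "finite S" "span S = UNIV"
    using finite_dim by blast
  obtain B where B: "B \<subseteq> U" "independent B" "U \<subseteq> span B"
    using maximal_independent_subset by blast
  from S B have "finite B"
    using independent_span_bound[of S B] by simp
  moreover from B assms have "span B = U"
    by (simp add: span_minimal subset_antisym)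
  ultimately show ?thesis by blast
qed

lemma orthonormal_span_exists:
  assumes "finite S"
  shows "\<exists>B. finite B \<and> orthonormal B \<and> span B = span S"
  using assms
proof induction
  case empty
  show ?case by (rule exI[of _ "{}"]) (simp add: orthonormal_def)
next
  case (insert a S)
  then obtain B where B: "finite B" "orthonormal B" "span B = span S" by blast
  define p where "p = (\<Sum>b\<in>B. scale (ip a b) b)"
  have p: "p \<in> span B"
    unfolding p_def by (intro span_sum span_scale span_base)
  have perp: "ip (a - p) b = 0" if "b \<in> B" for b
  proof -
    have "ip p b = (\<Sum>c\<in>B. ip a c * (if c = b then 1 else 0))"
      unfolding p_def ip_sum_left ip_scale_left
      by (rule sum.cong) (use B that in \<open>auto simp: orthonormal_def\<close>)
    also have "\<dots> = ip a b" using B that by (simp add: if_distrib cong: if_cong)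
    finally show ?thesis by (simp add: ip_diff_left)
  qed
  show ?case
  proof (cases "a = p")
    case True
    then have "a \<in> span S" using p B by simp
    then have "span (insert a S) = span S" by (rule span_redundant)
    then show ?thesis using B by blast
  next
    case False
    define t where "t = hnorm (a - p)"
    define c where "c = scale (of_real (1 / t)) (a - p)"
    have t: "t \<noteq> 0"
      using ip_self[of "a - p"] False by (auto simp: t_def)
    have cb: "ip c b = 0" if "b \<in> B" for b
      using perp[OF that] by (simp add: c_def ip_scale_left)
    have bc: "ip b c = 0" if "b \<in> B" for b
      using cb[OF that] ip_commute[of b c] by simp
    have cc: "ip c c = 1"
      using t ip_self[of "a - p"]
      by (simp add: c_def ip_scale_left ip_scale_right del: of_real_divide flip: t_def of_real_mult)
         (simp add: power2_eq_square)
    have "c \<notin> B" using cb cc by fastforce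
    have orth: "orthonormal (insert c B)"
      using B(2) cb bc cc \<open>c \<notin> B\<close> by (auto simp: orthonormal_def)
    have a: "a = scale (of_real t) c + p"
      using t by (simp add: c_def)
    have "a \<in> span (insert c B)"
      by (subst a) (intro span_add span_scale span_base[of c] set_mp[OF span_mono p], auto)
    then have "span (insert a S) \<subseteq> span (insert c B)"
      using B(3) span_superset[of S] span_mono[of B "insert c B"]
      by (intro span_minimal) auto
    moreover have "c \<in> span (insert a S)"
      unfolding c_def using p B(3) span_mono[of S "insert a S"]
      by (intro span_scale span_diff span_base[of a]) auto
    then have "span (insert c B) \<subseteq> span (insert a S)"
      using B(3) span_superset[of B] span_mono[of S "insert a S"]
      by (intro span_minimal) auto
    ultimately show ?thesis using B(1) orth by blast
  qed
qed

lemma orthonormal_basis_some: "orthonormal_basis (SOME B. orthonormal_basis B)"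
proof -
  obtain S where "finite S" "span S = UNIV" using finite_dim by blast
  then have "\<exists>B. orthonormal_basis B"
    using orthonormal_span_exists[of S] by (auto simp: orthonormal_basis_def)
  then show ?thesis by (rule someI_ex)
qed

lemma orthonormal_expand:
  assumes "finite B" "orthonormal B" "b \<in> B"
  shows "ip (\<Sum>c\<in>B. scale (a c) c) b = a b"
proof -
  have "ip (\<Sum>c\<in>B. scale (a c) c) b = (\<Sum>c\<in>B. a c * (if c = b then 1 else 0))"
    unfolding ip_sum_left ip_scale_left
    by (rule sum.cong) (use assms in \<open>auto simp: orthonormal_def\<close>)
  also have "\<dots> = a b" using assms by (simp add: if_distrib cong: if_cong)
  finally show ?thesis .
qed

lemma proj_ex1:
  assumes "subspace U"
  shows "\<exists>!g. g \<in> U \<and> (\<forall>u\<in>U. ip (f - g) u = 0)"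
proof -
  obtain S where S: "finite S" "span S = U"
    using subspace_finite_span[OF assms] by blast
  obtain B where B: "finite B" "orthonormal B" "span B = U"
    using orthonormal_span_exists[OF S(1)] S(2) by auto
  define g where "g = (\<Sum>b\<in>B. scale (ip f b) b)"
  have "g \<in> U"
    unfolding g_def B(3)[symmetric] by (intro span_sum span_scale span_base)
  moreover have "\<forall>b\<in>B. ip (f - g) b = 0"
    using orthonormal_expand[OF B(1,2)] by (simp add: g_def ip_diff_left)
  then have "\<forall>u\<in>U. ip (f - g) u = 0"
    using ip_span_0 B(3) by blast
  moreover have "h = g" if h: "h \<in> U" "\<forall>u\<in>U. ip (f - h) u = 0" for h
  proof -
    have "h - g \<in> U" using assms h(1) \<open>g \<in> U\<close> by (rule subspace_diff)
    then have "ip (f - g) (h - g) - ip (f - h) (h - g) = 0"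
      using h(2) \<open>\<forall>u\<in>U. ip (f - g) u = 0\<close> by simp
    then have "ip (h - g) (h - g) = 0"
      unfolding ip_diff_left[symmetric] by simp
    then show ?thesis by simp
  qed
  ultimately show ?thesis by blast
qed

lemma proj:
  assumes "subspace U"
  shows "proj U f \<in> U" and "\<forall>u\<in>U. ip (f - proj U f) u = 0"
  using theI'[OF proj_ex1[OF assms]] unfolding proj_def by blast+

lemma orthonormal_basis_expand:
  assumes "orthonormal_basis B"
  shows "x = (\<Sum>b\<in>B. scale (ip x b) b)"
proof -
  let ?d = "x - (\<Sum>b\<in>B. scale (ip x b) b)"
  have "\<forall>b\<in>B. ip ?d b = 0"
    using assms orthonormal_expand by (simp add: orthonormal_basis_def ip_diff_left)
  then have "ip ?d ?d = 0"
    using ip_span_0[of B ?d ?d] assms by (simp add: orthonormal_basis_def)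
  then show ?thesis by simp
qed

lemma parseval:
  assumes "orthonormal_basis B"
  shows "(hnorm x)\<^sup>2 = (\<Sum>b\<in>B. (norm (ip x b))\<^sup>2)"
proof -
  have "of_real ((hnorm x)\<^sup>2) = ip (\<Sum>b\<in>B. scale (ip x b) b) x"
    using orthonormal_basis_expand[OF assms, of x] ip_self[of x] by simp
  also have "\<dots> = (\<Sum>b\<in>B. ip x b * scnj (ip x b))"
    by (simp add: ip_sum_left ip_scale_left flip: ip_commute)
  also have "\<dots> = of_real (\<Sum>b\<in>B. (norm (ip x b))\<^sup>2)"
    by (simp add: mult_scnj scaleR_conv_of_real)
  finally show ?thesis using of_real_eq_iff by blast
qed

lemma ip_mult_ip: "ip x y * ip y x = of_real ((norm (ip x y))\<^sup>2)"
  using mult_scnj[of "ip x y"] by (simp add: scaleR_conv_of_real flip: ip_commute)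

lemma norm_ip_commute: "norm (ip x y) = norm (ip y x)"
proof -
  have "(norm z)\<^sup>2 = (norm (scnj z))\<^sup>2" for z :: 'k
    using mult_scnj[of z] mult_scnj[of "scnj z"]
    by (simp add: scnj_scnj mult.commute scaleR_conv_of_real del: of_real_power)
  then show ?thesis by (metis ip_commute norm_ge_zero power2_eq_imp_eq)
qed

text \<open>For linear maps, the Frobenius norm does not depend on the chosen orthonormal basis.\<close>

lemma frob_basis:
  assumes A: "Vector_Spaces.linear scale scale A" and B: "orthonormal_basis B"
  shows "frob A = sqrt (\<Sum>b\<in>B. (hnorm (A b))\<^sup>2)"
proof -
  interpret A: Vector_Spaces.linear scale scale A by (rule A)
  let ?C = "SOME B. orthonormal_basis B"
  define As where "As d = (\<Sum>c\<in>?C. scale (scnj (ip (A c) d)) c)" for d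
  have As: "ip (A x) d = ip x (As d)" for x d
  proof -
    have "A x = A (\<Sum>c\<in>?C. scale (ip x c) c)"
      by (rule arg_cong[OF orthonormal_basis_expand[OF orthonormal_basis_some]])
    also have "\<dots> = (\<Sum>c\<in>?C. scale (ip x c) (A c))"
      by (simp add: A.sum A.scale)
    finally show ?thesis
      by (simp add: As_def ip_sum_left ip_sum_right ip_scale_left ip_scale_right scnj_scnj mult.commute)
  qed
  have ind: "(\<Sum>b\<in>X. (hnorm (A b))\<^sup>2) = (\<Sum>d\<in>?C. (hnorm (As d))\<^sup>2)"
    if X: "orthonormal_basis X" for X
  proof -
    have "(\<Sum>b\<in>X. (hnorm (A b))\<^sup>2) = (\<Sum>b\<in>X. \<Sum>d\<in>?C. (norm (ip (As d) b))\<^sup>2)"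
      using parseval[OF orthonormal_basis_some] by (simp add: As norm_ip_commute)
    also have "\<dots> = (\<Sum>d\<in>?C. \<Sum>b\<in>X. (norm (ip (As d) b))\<^sup>2)" by (rule sum.swap)
    also have "\<dots> = (\<Sum>d\<in>?C. (hnorm (As d))\<^sup>2)" using parseval[OF X] by simp
    finally show ?thesis .
  qed
  show ?thesis unfolding frob_def using ind[OF B] ind[OF orthonormal_basis_some] by simp
qed

end

section \<open>The \<open>p\<close>-norm of a finite family\<close>

text \<open>Intended for \<open>p \<ge> 1\<close> and, if \<open>p = \<infinity>\<close>, for a nonempty index set.\<close>

definition pnorm :: "enat \<Rightarrow> 'j set \<Rightarrow> ('j \<Rightarrow> real) \<Rightarrow> real"
  where "pnorm p A x = (case p of
      enat n \<Rightarrow> root n (\<Sum>j\<in>A. \<bar>x j\<bar> ^ n)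
    | \<infinity> \<Rightarrow> Max ((\<lambda>j. \<bar>x j\<bar>) ` A))"

section \<open>Fusion frame systems\<close>

text \<open>
  Families over \<open>1, \<dots>, m\<close> are functions on \<open>nat\<close> and families over \<open>L i\<close> are functions on
  \<open>'l\<close>; of the spaces, weights and local frames, only the values at these indices are ever used.
  Members of the direct sums, on the other hand, vanish off their index set, so that equality of
  functions is equality of members and the operations are pointwise.
\<close>

locale fusion = fd_hilbert scale ip
  for scale :: "'k::real_or_complex \<Rightarrow> 'h::ab_group_add \<Rightarrow> 'h" and ip :: "'h \<Rightarrow> 'h \<Rightarrow> 'k" +
  fixes m :: nat and L :: "nat \<Rightarrow> 'l set"
  assumes finite_L: "i \<in> {1..m} \<Longrightarrow> finite (L i)"
begin

subsection \<open>Fusion frames and \<open>Q\<close>-duals\<close>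

definition weights :: "(nat \<Rightarrow> real) \<Rightarrow> bool"
  where "weights w \<longleftrightarrow> (\<forall>i\<in>{1..m}. w i > 0)"

definition fusion_frame :: "(nat \<Rightarrow> 'h set) \<Rightarrow> (nat \<Rightarrow> real) \<Rightarrow> bool"
  where "fusion_frame W w \<longleftrightarrow>
    (\<forall>i\<in>{1..m}. subspace (W i)) \<and> weights w \<and> span (\<Union>i\<in>{1..m}. W i) = UNIV"

definition dsum :: "(nat \<Rightarrow> 'h set) \<Rightarrow> (nat \<Rightarrow> 'h) set"
  where "dsum W = {f. (\<forall>i\<in>{1..m}. f i \<in> W i) \<and> (\<forall>i. i \<notin> {1..m} \<longrightarrow> f i = 0)}"

definition dsum_ip :: "(nat \<Rightarrow> 'h) \<Rightarrow> (nat \<Rightarrow> 'h) \<Rightarrow> 'k"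
  where "dsum_ip f g = (\<Sum>i=1..m. ip (f i) (g i))"

text \<open>The spaces enter the synthesis operator only through its domain \<open>dsum W\<close>.\<close>

definition synth :: "(nat \<Rightarrow> real) \<Rightarrow> (nat \<Rightarrow> 'h) \<Rightarrow> 'h"
  where "synth w f = (\<Sum>i=1..m. scale (of_real (w i)) (f i))"

definition synth_adj :: "(nat \<Rightarrow> 'h set) \<Rightarrow> (nat \<Rightarrow> real) \<Rightarrow> 'h \<Rightarrow> (nat \<Rightarrow> 'h)"
  where "synth_adj W w f =
    (\<lambda>i. if i \<in> {1..m} then scale (of_real (w i)) (proj (W i) f) else 0)"

lemma synth_adjoint:
  assumes "fusion_frame W w" and "f \<in> dsum W"
  shows "ip (synth w f) h = dsum_ip f (synth_adj W w h)"
proof -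
  have "ip (f i) h = ip (f i) (proj (W i) h)" if "i \<in> {1..m}" for i
  proof -
    have "subspace (W i)" "f i \<in> W i"
      using assms that by (auto simp: fusion_frame_def dsum_def)
    then have "ip (h - proj (W i) h) (f i) = 0" using proj by blast
    then have "ip h (f i) = ip (proj (W i) h) (f i)" by (simp add: ip_diff_left)
    then show ?thesis by (metis ip_commute)
  qed
  then show ?thesis
    by (simp add: synth_def dsum_ip_def synth_adj_def ip_sum_left ip_scale_left ip_scale_right)
qed

lemma synth_adj_in: "fusion_frame W w \<Longrightarrow> synth_adj W w h \<in> dsum W"
  by (auto simp: synth_adj_def dsum_def fusion_frame_def intro!: subspace_scale proj)

definition comp_mask :: "nat \<Rightarrow> (nat \<Rightarrow> 'h) \<Rightarrow> (nat \<Rightarrow> 'h)"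
  where "comp_mask j f = (\<lambda>i. if i = j then f i else 0)"

definition dsum_linear ::
    "(nat \<Rightarrow> 'h set) \<Rightarrow> (nat \<Rightarrow> 'h set) \<Rightarrow> ((nat \<Rightarrow> 'h) \<Rightarrow> (nat \<Rightarrow> 'h)) \<Rightarrow> bool"
  where "dsum_linear W V Q \<longleftrightarrow>
    (\<forall>f\<in>dsum W. Q f \<in> dsum V) \<and>
    (\<forall>f\<in>dsum W. \<forall>g\<in>dsum W. Q (\<lambda>i. f i + g i) = (\<lambda>i. Q f i + Q g i)) \<and>
    (\<forall>a. \<forall>f\<in>dsum W. Q (\<lambda>i. scale a (f i)) = (\<lambda>i. scale a (Q f i)))"

definition component_preserving ::
    "(nat \<Rightarrow> 'h set) \<Rightarrow> (nat \<Rightarrow> 'h set) \<Rightarrow> ((nat \<Rightarrow> 'h) \<Rightarrow> (nat \<Rightarrow> 'h)) \<Rightarrow> bool"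
  where "component_preserving W V Q \<longleftrightarrow>
    dsum_linear W V Q \<and>
    (\<forall>j\<in>{1..m}. Q ` comp_mask j ` dsum W = comp_mask j ` dsum V)"

definition Q_dual :: "((nat \<Rightarrow> 'h) \<Rightarrow> (nat \<Rightarrow> 'h)) \<Rightarrow>
    (nat \<Rightarrow> 'h set) \<Rightarrow> (nat \<Rightarrow> real) \<Rightarrow> (nat \<Rightarrow> 'h set) \<Rightarrow> (nat \<Rightarrow> real) \<Rightarrow> bool"
  where "Q_dual Q W w V v \<longleftrightarrow>
    fusion_frame W w \<and> fusion_frame V v \<and> dsum_linear W V Q \<and>
    (\<forall>f. synth v (Q (synth_adj W w f)) = f)"

subsection \<open>Systems and their duals\<close>

definition fusion_frame_system ::
    "(nat \<Rightarrow> 'h set) \<Rightarrow> (nat \<Rightarrow> real) \<Rightarrow> (nat \<Rightarrow> 'l \<Rightarrow> 'h) \<Rightarrow> bool"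
  where "fusion_frame_system W w F \<longleftrightarrow>
    fusion_frame W w \<and> (\<forall>i\<in>{1..m}. span (F i ` L i) = W i)"

definition frame_op :: "(nat \<Rightarrow> 'l \<Rightarrow> 'h) \<Rightarrow> 'h \<Rightarrow> 'h"
  where "frame_op F f = (\<Sum>i=1..m. \<Sum>l\<in>L i. scale (ip f (F i l)) (F i l))"

definition coeffs :: "(nat \<Rightarrow> 'l \<Rightarrow> 'k) set"
  where "coeffs = {x. \<forall>i l. \<not> (i \<in> {1..m} \<and> l \<in> L i) \<longrightarrow> x i l = 0}"

definition coeffs_ip :: "(nat \<Rightarrow> 'l \<Rightarrow> 'k) \<Rightarrow> (nat \<Rightarrow> 'l \<Rightarrow> 'k) \<Rightarrow> 'k"
  where "coeffs_ip x y = (\<Sum>i=1..m. \<Sum>l\<in>L i. x i l * scnj (y i l))"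

definition lsynth :: "(nat \<Rightarrow> 'l \<Rightarrow> 'h) \<Rightarrow> (nat \<Rightarrow> 'l \<Rightarrow> 'k) \<Rightarrow> (nat \<Rightarrow> 'h)"
  where "lsynth F x =
    (\<lambda>i. if i \<in> {1..m} then (\<Sum>l\<in>L i. scale (x i l) (F i l)) else 0)"

definition lsynth_adj :: "(nat \<Rightarrow> 'l \<Rightarrow> 'h) \<Rightarrow> (nat \<Rightarrow> 'h) \<Rightarrow> (nat \<Rightarrow> 'l \<Rightarrow> 'k)"
  where "lsynth_adj F g =
    (\<lambda>i l. if i \<in> {1..m} \<and> l \<in> L i then ip (g i) (F i l) else 0)"

lemma lsynth_adjoint: "dsum_ip (lsynth F x) g = coeffs_ip x (lsynth_adj F g)"
  by (simp add: dsum_ip_def lsynth_def coeffs_ip_def lsynth_adj_def ip_sum_left ip_scale_left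
      flip: ip_commute)

lemma bij_frame_op:
  assumes "fusion_frame_system W w F"
  shows "bij (frame_op F)"
proof -
  have lin: "Vector_Spaces.linear scale scale (frame_op F)"
    by unfold_locales
       (simp_all add: frame_op_def ip_add_left ip_scale_left scale_left_distrib sum.distrib
          scale_sum_right)
  interpret S: Vector_Spaces.linear scale scale "frame_op F" by (rule lin)
  have "x = 0" if "frame_op F x = 0" for x
  proof -
    have "(\<Sum>i=1..m. \<Sum>l\<in>L i. (norm (ip x (F i l)))\<^sup>2) = 0"
    proof -
      have "of_real (\<Sum>i=1..m. \<Sum>l\<in>L i. (norm (ip x (F i l)))\<^sup>2) = ip (frame_op F x) x"
        by (simp add: frame_op_def ip_sum_left ip_scale_left ip_mult_ip)
      then show ?thesis using that by (simp del: of_real_sum of_real_power)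
    qed
    then have "\<forall>i\<in>{1..m}. (\<Sum>l\<in>L i. (norm (ip x (F i l)))\<^sup>2) = 0"
      by (subst (asm) sum_nonneg_eq_0_iff) (auto intro: sum_nonneg)
    then have F0: "ip x (F i l) = 0" if "i \<in> {1..m}" "l \<in> L i" for i l
      using that finite_L sum_nonneg_eq_0_iff[of "L i" "\<lambda>l. (norm (ip x (F i l)))\<^sup>2"] by auto
    have W0: "\<forall>u\<in>(\<Union>i\<in>{1..m}. W i). ip x u = 0"
    proof
      fix u assume "u \<in> (\<Union>i\<in>{1..m}. W i)"
      then obtain i where i: "i \<in> {1..m}" "u \<in> W i" by blast
      then have "u \<in> span (F i ` L i)" using assms by (auto simp: fusion_frame_system_def)
      then show "ip x u = 0" using F0[OF i(1)] ip_span_0[of "F i ` L i"] by blast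
    qed
    have "ip x x = 0"
      using ip_span_0[OF W0, of x] assms by (simp add: fusion_frame_system_def fusion_frame_def)
    then show ?thesis by simp
  qed
  then have inj: "inj (frame_op F)" by (simp add: S.inj_iff_eq_0)
  obtain S0 where "finite S0" "span S0 = UNIV" using finite_dim by blast
  obtain B where B: "independent B" "span B = UNIV"
    using maximal_independent_subset[of UNIV] by (metis top.extremum_uniqueI)
  have "finite B" using independent_span_bound[of S0 B] \<open>finite S0\<close> \<open>span S0 = UNIV\<close> B by simp
  then interpret fd: finite_dimensional_vector_space scale B
    using B by unfold_locales auto
  from inj lin have "surj (frame_op F)" by (simp add: fd.linear_inj_imp_surj)
  with inj show ?thesis by (simp add: bij_def)
qed

definition dual_system ::
    "(nat \<Rightarrow> 'h set) \<Rightarrow> (nat \<Rightarrow> real) \<Rightarrow> (nat \<Rightarrow> 'l \<Rightarrow> 'h) \<Rightarrow>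
     (nat \<Rightarrow> 'h set) \<Rightarrow> (nat \<Rightarrow> real) \<Rightarrow> (nat \<Rightarrow> 'l \<Rightarrow> 'h) \<Rightarrow> bool"
  where "dual_system W w F V v G \<longleftrightarrow>
    fusion_frame_system W w F \<and> fusion_frame_system V v G \<and>
    Q_dual (lsynth G \<circ> lsynth_adj F) W w V v"

definition cp_dual_system ::
    "(nat \<Rightarrow> 'h set) \<Rightarrow> (nat \<Rightarrow> real) \<Rightarrow> (nat \<Rightarrow> 'l \<Rightarrow> 'h) \<Rightarrow>
     (nat \<Rightarrow> 'h set) \<Rightarrow> (nat \<Rightarrow> real) \<Rightarrow> (nat \<Rightarrow> 'l \<Rightarrow> 'h) \<Rightarrow> bool"
  where "cp_dual_system W w F V v G \<longleftrightarrow>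
    dual_system W w F V v G \<and> component_preserving W V (lsynth G \<circ> lsynth_adj F)"

subsection \<open>Loss optimality\<close>

text \<open>
  The index tuples of total size \<open>r\<close>. The extensional function space makes every tuple occur
  exactly once.
\<close>

definition losses :: "nat \<Rightarrow> (nat \<Rightarrow> 'l set) set"
  where "losses r = {J \<in> (\<Pi>\<^sub>E i\<in>{1..m}. Pow (L i)). (\<Sum>i=1..m. card (J i)) = r}"

definition coeff_mask :: "(nat \<Rightarrow> 'l set) \<Rightarrow> (nat \<Rightarrow> 'l \<Rightarrow> 'k) \<Rightarrow> (nat \<Rightarrow> 'l \<Rightarrow> 'k)"
  where "coeff_mask J x = (\<lambda>i l. if i \<in> {1..m} \<and> l \<in> J i then x i l else 0)"

definition loss_error ::
    "(nat \<Rightarrow> 'h set) \<Rightarrow> (nat \<Rightarrow> real) \<Rightarrow> (nat \<Rightarrow> 'l \<Rightarrow> 'h) \<Rightarrow>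
     (nat \<Rightarrow> 'h set) \<times> (nat \<Rightarrow> real) \<times> (nat \<Rightarrow> 'l \<Rightarrow> 'h) \<Rightarrow> (nat \<Rightarrow> 'l set) \<Rightarrow> real"
  where "loss_error W w F = (\<lambda>(V, v, G) J.
    frob (\<lambda>f. synth v (lsynth G (coeff_mask J (lsynth_adj F (synth_adj W w f))))))"

text \<open>
  The recursion starts from stage 0, the set of all dual systems; the stages of the paper are
  those with index at least 1.
\<close>

primrec loss_optimal ::
    "enat \<Rightarrow> (nat \<Rightarrow> 'h set) \<Rightarrow> (nat \<Rightarrow> real) \<Rightarrow> (nat \<Rightarrow> 'l \<Rightarrow> 'h) \<Rightarrow> nat \<Rightarrow>
     ((nat \<Rightarrow> 'h set) \<times> (nat \<Rightarrow> real) \<times> (nat \<Rightarrow> 'l \<Rightarrow> 'h)) set"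
  where
    "loss_optimal p W w F 0 = {(V, v, G). dual_system W w F V v G}"
  | "loss_optimal p W w F (Suc r) =
      {X \<in> loss_optimal p W w F r.
        pnorm p (losses (Suc r)) (loss_error W w F X) =
        (INF Y \<in> loss_optimal p W w F r. pnorm p (losses (Suc r)) (loss_error W w F Y))}"

subsection \<open>The canonical candidate\<close>

definition can_spaces :: "(nat \<Rightarrow> 'l \<Rightarrow> 'h) \<Rightarrow> (nat \<Rightarrow> 'h set) \<Rightarrow> (nat \<Rightarrow> 'h set)"
  where "can_spaces F W = (\<lambda>i. inv (frame_op F) ` W i)"

definition can_frames ::
    "(nat \<Rightarrow> real) \<Rightarrow> (nat \<Rightarrow> real) \<Rightarrow> (nat \<Rightarrow> 'l \<Rightarrow> 'h) \<Rightarrow> (nat \<Rightarrow> 'l \<Rightarrow> 'h)"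
  where "can_frames w v F =
    (\<lambda>i l. scale (of_real (1 / (w i * v i))) (inv (frame_op F) (F i l)))"

end

end

theory Submission
  imports Defs
begin

text \<open>
  Since \<open>f\<^sub>i\<^sup>l \<in> W\<^sub>i\<close>, a dual system enters all error operators only through the rescaled vectors
  \<open>h\<^sub>i\<^sup>l = w\<^sub>i v\<^sub>i g\<^sub>i\<^sup>l\<close>, and duality says precisely that these form a dual frame of \<open>\<F>\<close>. For a single
  lost vector the error operator has rank one and Frobenius norm \<open>\<parallel>h\<^sub>i\<^sup>l\<parallel>\<close>, because \<open>\<parallel>f\<^sub>i\<^sup>l\<parallel> = 1\<close>. Hence
  stage 1 minimises the total squared norm over the dual frames of \<open>\<F>\<close>; by Pythagoras the only
  minimiser is the canonical dual frame \<open>S\<^sup>-\<^sup>1 f\<^sub>i\<^sup>l\<close>. So the \<open>h\<^sub>i\<^sup>l\<close> are already determined after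
  stage 1, and the later stages cannot change anything.
\<close>

section \<open>Rank-one operators, dual frames and local frame operators in a Hilbert space\<close>

context fd_hilbert
begin

lemma hnorm_nonneg: "0 \<le> hnorm x"
  by (simp add: hnorm_def)

lemma hnorm_eq_0_iff [simp]: "hnorm x = 0 \<longleftrightarrow> x = 0"
  by (simp add: hnorm_def)

lemma ip_diff_right: "ip x (y - z) = ip x y - ip x z"
  using ip_add_right[of x "y - z" z] by (simp add: algebra_simps)

lemma hnorm_scale_sq: "(hnorm (scale a x))\<^sup>2 = (norm a)\<^sup>2 * (hnorm x)\<^sup>2"
proof (cases "x = 0")
  case False
  \<comment> \<open>Conjugation invariance of the scalar norm comes from symmetry of
    \<open>norm (ip x y)\<close> at \<open>y = scale a x\<close>, where the nonzero factor
    \<open>norm (ip x x)\<close> cancels.\<close>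
  then have "norm (scnj a) = norm a"
    using norm_ip_commute[of x "scale a x"] by (simp add: ip_scale_left ip_scale_right norm_mult)
  then show ?thesis
    by (simp add: hnorm_def ip_scale_left ip_scale_right norm_mult power2_eq_square)
qed (simp add: hnorm_def)

text \<open>Summing \<open>norm (ip b a)\<close> squared over an orthonormal basis gives the squared
  norm of \<open>a\<close> by Parseval; the norm of \<open>g\<close> is a constant factor.\<close>

lemma frob_rank_one: "frob (\<lambda>x. scale (ip x a) g) = hnorm a * hnorm g"
proof -
  let ?B = "SOME B. orthonormal_basis B"
  have "(\<Sum>b\<in>?B. (hnorm (scale (ip b a) g))\<^sup>2) = (hnorm a)\<^sup>2 * (hnorm g)\<^sup>2"
    by (simp add: hnorm_scale_sq parseval[OF orthonormal_basis_some, of a] norm_ip_commute[of _ a]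
        sum_distrib_right)
  then show ?thesis
    by (simp add: frob_def real_sqrt_mult hnorm_nonneg)
qed

lemma ip_orthonormal_basis:
  assumes "orthonormal_basis B"
  shows "ip x y = (\<Sum>b\<in>B. ip x b * ip b y)"
proof -
  have "ip x y = ip (\<Sum>b\<in>B. scale (ip x b) b) y"
    using orthonormal_basis_expand[OF assms, of x] by simp
  then show ?thesis by (simp add: ip_sum_left ip_scale_left)
qed

text \<open>The differences \<open>g a - c a\<close> of two dual frames synthesise to zero against
  the coefficients of \<open>f\<close>. As \<open>c\<close> is the image of \<open>f\<close> under a
  self-adjoint map, this makes the family of differences orthogonal to \<open>c\<close>, so the
  cross terms vanish.\<close>

lemma dual_frame_pythagoras:
  assumes T: "\<And>x y. ip (T x) y = ip x (T y)"
    and c: "\<And>a. a \<in> I \<Longrightarrow> c a = T (f a)"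
    and dual_c: "\<And>x. (\<Sum>a\<in>I. scale (ip x (f a)) (c a)) = x"
    and dual_g: "\<And>x. (\<Sum>a\<in>I. scale (ip x (f a)) (g a)) = x"
  shows "(\<Sum>a\<in>I. (hnorm (g a))\<^sup>2) = (\<Sum>a\<in>I. (hnorm (c a))\<^sup>2) + (\<Sum>a\<in>I. (hnorm (g a - c a))\<^sup>2)"
proof -
  let ?h = "\<lambda>a. g a - c a"
  let ?B = "SOME B. orthonormal_basis B"
  have h0: "(\<Sum>a\<in>I. scale (ip x (f a)) (?h a)) = 0" for x
    by (simp add: scale_right_diff_distrib sum_subtractf dual_c dual_g)
  \<comment> \<open>The sum is the trace of \<open>x \<mapsto> \<Sum> \<langle>T x, f a\<rangle> h a = 0\<close>.\<close>
  have hc: "(\<Sum>a\<in>I. ip (?h a) (c a)) = 0"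
  proof -
    have "(\<Sum>a\<in>I. ip (?h a) (c a)) = (\<Sum>a\<in>I. \<Sum>b\<in>?B. ip (?h a) b * ip (T b) (f a))"
    proof (rule sum.cong[OF refl])
      fix a assume "a \<in> I"
      then have "ip b (c a) = ip (T b) (f a)" for b
        by (simp add: c T)
      then show "ip (?h a) (c a) = (\<Sum>b\<in>?B. ip (?h a) b * ip (T b) (f a))"
        by (subst ip_orthonormal_basis[OF orthonormal_basis_some]) simp
    qed
    also have "\<dots> = (\<Sum>b\<in>?B. ip (\<Sum>a\<in>I. scale (ip (T b) (f a)) (?h a)) b)"
      by (subst sum.swap) (simp add: ip_sum_left ip_scale_left mult.commute)
    also have "\<dots> = 0" by (simp only: h0 ip_0_left sum.neutral_const)
    finally show ?thesis .
  qed
  have scnj_sum: "scnj (\<Sum>a\<in>A. z a) = (\<Sum>a\<in>A. scnj (z a))" for A and z :: "_ \<Rightarrow> 'k"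
    by (induction A rule: infinite_finite_induct) (simp_all add: scnj_add)
  have ch: "(\<Sum>a\<in>I. ip (c a) (?h a)) = 0"
    using arg_cong[OF hc, of scnj] by (simp add: scnj_sum flip: ip_commute)
  have "ip (g a) (g a) = ip (c a) (c a) + ip (?h a) (?h a) + (ip (?h a) (c a) + ip (c a) (?h a))" for a
    by (simp add: ip_diff_left ip_diff_right)
  then have "(\<Sum>a\<in>I. ip (g a) (g a)) = (\<Sum>a\<in>I. ip (c a) (c a)) + (\<Sum>a\<in>I. ip (?h a) (?h a))"
    by (simp only: sum.distrib hc ch add_0_right)
  then have "of_real (\<Sum>a\<in>I. (hnorm (g a))\<^sup>2) =
      (of_real ((\<Sum>a\<in>I. (hnorm (c a))\<^sup>2) + (\<Sum>a\<in>I. (hnorm (?h a))\<^sup>2)) :: 'k)"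
    by (simp add: ip_self)
  then show ?thesis using of_real_eq_iff by blast
qed

text \<open>The frame operator of a finite family maps the span of the family onto itself: a vector
  of the span orthogonal to the range has all frame coefficients zero, hence is zero. This provides
  the preimages needed for component preservation.\<close>

lemma local_frame_op_surj:
  assumes "finite A" and "y \<in> span (f ` A)"
  shows "\<exists>x \<in> span (f ` A). (\<Sum>a\<in>A. scale (ip x (f a)) (f a)) = y"
proof -
  define S where "S = (\<lambda>x. \<Sum>a\<in>A. scale (ip x (f a)) (f a))"
  interpret S: Vector_Spaces.linear scale scale S
    by unfold_locales
       (simp_all add: S_def ip_add_left ip_scale_left scale_left_distrib sum.distrib scale_sum_right)
  have R: "subspace (range S)" by (rule S.subspace_image[OF subspace_UNIV])
  define d where "d = y - proj (range S) y"
  have SU: "S x \<in> span (f ` A)" for x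
    unfolding S_def by (intro span_sum span_scale span_base) auto
  have pU: "proj (range S) y \<in> span (f ` A)"
    using proj(1)[OF R, of y] SU by auto
  have dU: "d \<in> span (f ` A)"
    unfolding d_def by (intro span_diff assms(2) pU)
  \<comment> \<open>The residual \<open>d\<close> is orthogonal to the range of \<open>S\<close>, in
    particular to \<open>S d\<close>.\<close>
  have "ip d (S d) = 0"
    using proj(2)[OF R, of y] by (simp add: d_def)
  then have "ip (S d) d = 0" by (metis ip_commute scnj_0)
  moreover have "ip (S d) d = of_real (\<Sum>a\<in>A. (norm (ip d (f a)))\<^sup>2)"
    by (simp add: S_def ip_sum_left ip_scale_left ip_mult_ip)
  ultimately have "(\<Sum>a\<in>A. (norm (ip d (f a)))\<^sup>2) = 0"
    by (simp del: of_real_sum of_real_power)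
  then have "\<forall>b\<in>f ` A. ip d b = 0"
    using assms(1) by (simp add: sum_nonneg_eq_0_iff)
  then have "ip d d = 0" using ip_span_0 dU by blast
  then have "y = proj (range S) y" by (simp add: d_def)
  then obtain x where x: "y = S x" using proj(1)[OF R, of y] by auto
  \<comment> \<open>A preimage may lie outside the span; projecting it into the span changes none of
    its coefficients against \<open>f\<close>, hence not its image.\<close>
  let ?x = "proj (span (f ` A)) x"
  have "ip ?x (f a) = ip x (f a)" if "a \<in> A" for a
    using proj(2)[OF subspace_span, of "f ` A" x] span_base[of "f a" "f ` A"] that
    by (simp add: ip_diff_left)
  then have "S ?x = S x" by (simp add: S_def)
  then show ?thesis using x proj(1)[OF subspace_span, of "f ` A" x] by (auto simp: S_def)
qed

end

section \<open>Losses of a single vector\<close>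

declare One_nat_def [simp del]

text \<open>Turns sums over the loss tuples of size 1 into sums over the frame indices. The
  restricted lambda places each tuple in the extensional function space that defines
  \<open>losses\<close>.\<close>

lemma bij_betw_losses_1:
  assumes "fusion scale ip m L"
  shows "bij_betw (\<lambda>(i, l). \<lambda>j\<in>{1..m}. if j = i then {l} else {}) (Sigma {1..m} L)
    (fusion.losses m L 1)"
    (is "bij_betw ?J ?I _")
proof -
  interpret fusion scale ip m L by (rule assms)
  show ?thesis
  proof (rule bij_betw_imageI)
    show "inj_on ?J ?I"
    proof (rule inj_onI)
      fix a b assume a: "a \<in> ?I" "b \<in> ?I" and eq: "?J a = ?J b"
      obtain i l k n where ab: "a = (i, l)" "b = (k, n)" by (metis surj_pair)
      \<comment> \<open>Evaluation at \<open>i\<close> decides injectivity: a singleton is not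
        empty, so \<open>i = k\<close>, and then \<open>l = n\<close>.\<close>
      then have "{l} = (if i = k then {n} else {})"
        using a(1) fun_cong[OF eq, of i] by simp
      then show "a = b" by (cases "i = k") (simp_all add: ab)
    qed
    show "?J ` ?I = losses 1"
    proof (rule set_eqI, rule iffI)
      fix J assume "J \<in> ?J ` ?I"
      then obtain i l where i: "i \<in> {1..m}" "l \<in> L i" and J: "J = ?J (i, l)" by auto
      have "(\<Sum>j=1..m. card (J j)) = (\<Sum>j=1..m. if j = i then 1 else 0)"
        by (rule sum.cong) (auto simp: J)
      then show "J \<in> losses 1" using i by (auto simp: losses_def J)
    next
      fix J assume J: "J \<in> losses 1"
      then have JL: "J \<in> (\<Pi>\<^sub>E i\<in>{1..m}. Pow (L i))" and s: "(\<Sum>i=1..m. card (J i)) = 1"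
        by (auto simp: losses_def)
      from s obtain i where i: "i \<in> {1..m}" "card (J i) = 1"
        and z: "\<forall>j\<in>{1..m}. i \<noteq> j \<longrightarrow> card (J j) = 0"
        by (subst (asm) sum_eq_1_iff) auto
      have sub: "J j \<subseteq> L j" "finite (J j)" if "j \<in> {1..m}" for j
        using PiE_mem[OF JL that] finite_L[OF that] finite_subset by auto
      obtain l where l: "J i = {l}" using i(2) card_1_singletonE by blast
      have "J = ?J (i, l)"
      proof
        fix j show "J j = ?J (i, l) j"
        proof (cases "j \<in> {1..m} \<and> j \<noteq> i")
          case True
          then have "J j = {}" using z sub(2) by (metis card_0_eq)
          with True show ?thesis by simp
        next
          case False
          \<comment> \<open>Either \<open>j = i\<close>, or \<open>j\<close> lies outside
            \<open>{1..m}\<close>, where both sides take the default value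
            \<open>undefined\<close>.\<close>
          then show ?thesis using PiE_arb[OF JL, of j] l i(1) by auto
        qed
      qed
      moreover have "l \<in> L i" using sub(1)[OF i(1)] l by auto
      ultimately show "J \<in> ?J ` ?I" using i(1) by (intro image_eqI[of _ _ "(i, l)"]) auto
    qed
  qed
qed

section \<open>The frame operator and the canonical dual frame\<close>

context fusion
begin

lemma linear_frame_op: "Vector_Spaces.linear scale scale (frame_op F)"
  by unfold_locales
     (simp_all add: frame_op_def ip_add_left ip_scale_left scale_left_distrib sum.distrib
        scale_sum_right)

lemma frame_op_self_adjoint: "ip (frame_op F x) y = ip x (frame_op F y)"
  by (simp add: frame_op_def ip_sum_left ip_sum_right ip_scale_left ip_scale_right mult.commute
      flip: ip_commute)

lemma frame_op_inv:
  assumes "fusion_frame_system W w F"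
  shows "frame_op F (inv (frame_op F) x) = x" and "inv (frame_op F) (frame_op F x) = x"
  using bij_frame_op[OF assms] by (simp_all add: bij_def surj_f_inv_f)

lemma linear_inv_frame_op:
  assumes "fusion_frame_system W w F"
  shows "Vector_Spaces.linear scale scale (inv (frame_op F))"
proof -
  interpret S: Vector_Spaces.linear scale scale "frame_op F" by (rule linear_frame_op)
  show ?thesis
    by unfold_locales (metis frame_op_inv[OF assms] S.add, metis frame_op_inv[OF assms] S.scale)
qed

lemma inv_frame_op_self_adjoint:
  assumes "fusion_frame_system W w F"
  shows "ip (inv (frame_op F) x) y = ip x (inv (frame_op F) y)"
  by (metis frame_op_inv(1)[OF assms] frame_op_self_adjoint)

text \<open>Apply the linear inverse to \<open>frame_op F x\<close> and move it inside the
  sums.\<close>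

lemma canonical_dual_frame:
  assumes "fusion_frame_system W w F"
  shows "(\<Sum>i=1..m. \<Sum>l\<in>L i. scale (ip x (F i l)) (inv (frame_op F) (F i l))) = x"
proof -
  interpret T: Vector_Spaces.linear scale scale "inv (frame_op F)"
    by (rule linear_inv_frame_op[OF assms])
  show ?thesis
    using frame_op_inv(2)[OF assms, of x] by (simp add: frame_op_def T.sum T.scale)
qed

section \<open>Error operators in terms of rescaled frame vectors\<close>

lemma frame_system_mem:
  assumes "fusion_frame_system W w F" "i \<in> {1..m}" "l \<in> L i"
  shows "F i l \<in> W i"
  using assms span_base[of "F i l" "F i ` L i"] by (auto simp: fusion_frame_system_def)

text \<open>This removes the projections, and with them the spaces \<open>W i\<close>, from all
  error operators.\<close>

lemma ip_proj_frame:
  assumes "fusion_frame_system W w F" "i \<in> {1..m}" "l \<in> L i"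
  shows "ip (proj (W i) x) (F i l) = ip x (F i l)"
proof -
  have "subspace (W i)" using assms by (simp add: fusion_frame_system_def fusion_frame_def)
  then have "ip (x - proj (W i) x) (F i l) = 0" using proj(2) frame_system_mem[OF assms] by blast
  then show ?thesis by (simp add: ip_diff_left)
qed

text \<open>These are the vectors \<open>h\<^sub>i\<^sup>l\<close> of the overview: the factor
  \<open>w i\<close> stems from analysis, \<open>v i\<close> from synthesis.\<close>

definition weighted_frame ::
    "(nat \<Rightarrow> real) \<Rightarrow> (nat \<Rightarrow> real) \<Rightarrow> (nat \<Rightarrow> 'l \<Rightarrow> 'h) \<Rightarrow> nat \<Rightarrow> 'l \<Rightarrow> 'h"
  where "weighted_frame w v G i l = scale (of_real (w i * v i)) (G i l)"

text \<open>\<open>J\<close> may be any family of sets: \<open>J = L\<close> yields full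
  reconstruction, hence the duality condition, and a singleton tuple yields a rank-one
  operator.\<close>

lemma loss_operator_eq:
  assumes "fusion_frame_system W w F"
  shows "synth v (lsynth G (coeff_mask J (lsynth_adj F (synth_adj W w x)))) =
    (\<Sum>i=1..m. \<Sum>l\<in>L i. if l \<in> J i then scale (ip x (F i l)) (weighted_frame w v G i l) else 0)"
  unfolding synth_def
proof (rule sum.cong[OF refl])
  fix i assume i: "i \<in> {1..m}"
  have "scale (of_real (v i)) (scale (coeff_mask J (lsynth_adj F (synth_adj W w x)) i l) (G i l)) =
      (if l \<in> J i then scale (ip x (F i l)) (weighted_frame w v G i l) else 0)" if "l \<in> L i" for l
    using i that ip_proj_frame[OF assms i that, of x]
    by (simp add: coeff_mask_def lsynth_adj_def synth_adj_def ip_scale_left weighted_frame_def ac_simps)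
  then show "scale (of_real (v i)) (lsynth G (coeff_mask J (lsynth_adj F (synth_adj W w x))) i) =
      (\<Sum>l\<in>L i. if l \<in> J i then scale (ip x (F i l)) (weighted_frame w v G i l) else 0)"
    using i by (simp add: lsynth_def scale_sum_right)
qed

lemma reconstruction_eq:
  assumes "fusion_frame_system W w F"
  shows "synth v (lsynth G (lsynth_adj F (synth_adj W w x))) =
    (\<Sum>i=1..m. \<Sum>l\<in>L i. scale (ip x (F i l)) (weighted_frame w v G i l))"
proof -
  have "coeff_mask L (lsynth_adj F (synth_adj W w x)) = lsynth_adj F (synth_adj W w x)"
    by (auto simp: coeff_mask_def lsynth_adj_def fun_eq_iff)
  then show ?thesis using loss_operator_eq[OF assms, of v G L x] by simp
qed

lemma dual_system_reconstruction:
  assumes "dual_system W w F V v G"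
  shows "(\<Sum>i=1..m. \<Sum>l\<in>L i. scale (ip x (F i l)) (weighted_frame w v G i l)) = x"
  using assms reconstruction_eq[of W w F v G x] by (simp add: dual_system_def Q_dual_def)

text \<open>Systems with equal rescaled vectors have equal errors for every \<open>J\<close>, so no
  stage can tell them apart.\<close>

lemma loss_error_cong:
  assumes "fusion_frame_system W w F"
    and "\<And>i l. i \<in> {1..m} \<Longrightarrow> l \<in> L i \<Longrightarrow> weighted_frame w v G i l = weighted_frame w v' G' i l"
  shows "loss_error W w F (V, v, G) = loss_error W w F (V', v', G')"
proof
  fix J
  show "loss_error W w F (V, v, G) J = loss_error W w F (V', v', G') J"
    unfolding loss_error_def prod.case loss_operator_eq[OF assms(1)]
    by (intro arg_cong[where f = frob] ext sum.cong refl) (simp add: assms(2))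
qed

lemma loss_error_single:
  assumes "fusion_frame_system W w F" and il: "i \<in> {1..m}" "l \<in> L i"
  shows "loss_error W w F (V, v, G) (\<lambda>j\<in>{1..m}. if j = i then {l} else {}) =
    hnorm (F i l) * hnorm (weighted_frame w v G i l)"
proof -
  let ?J = "\<lambda>j\<in>{1..m}. if j = i then {l} else {}"
  have "(\<Sum>j=1..m. \<Sum>k\<in>L j. if k \<in> ?J j then scale (ip x (F j k)) (weighted_frame w v G j k) else 0)
      = scale (ip x (F i l)) (weighted_frame w v G i l)" (is "?lhs x = ?rhs x") for x
  proof -
    have "?lhs x = (\<Sum>j=1..m. if j = i then (\<Sum>k\<in>L i. if k = l then ?rhs x else 0) else 0)"
      by (intro sum.cong refl) (auto intro!: sum.cong sum.neutral)
    also have "\<dots> = ?rhs x" using il finite_L[OF il(1)] by simp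
    finally show ?thesis .
  qed
  then show ?thesis
    by (simp only: loss_error_def loss_operator_eq[OF assms(1)] prod.case frob_rank_one)
qed

lemma pnorm_2_losses_1:
  assumes "fusion_frame_system W w F" and "\<forall>i\<in>{1..m}. \<forall>l\<in>L i. hnorm (F i l) = 1"
  shows "pnorm 2 (losses 1) (loss_error W w F (V, v, G)) =
    sqrt (\<Sum>(i, l)\<in>Sigma {1..m} L. (hnorm (weighted_frame w v G i l))\<^sup>2)"
proof -
  have "(\<Sum>J\<in>losses 1. (loss_error W w F (V, v, G) J)\<^sup>2) =
      (\<Sum>(i, l)\<in>Sigma {1..m} L. (hnorm (weighted_frame w v G i l))\<^sup>2)"
    by (subst sum.reindex_bij_betw[OF bij_betw_losses_1[OF fusion_axioms], symmetric], rule sum.cong)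
       (use assms in \<open>auto simp: loss_error_single\<close>)
  \<comment> \<open>The numeral must be exposed as \<open>enat 2\<close> to select the finite case
    of \<open>pnorm\<close>, and \<open>sqrt\<close> is \<open>root 2\<close>.\<close>
  then show ?thesis by (simp add: pnorm_def sqrt_def numeral_eq_enat)
qed

section \<open>The canonical dual system\<close>

lemma weights_mult_nonzero:
  assumes "weights w" "weights v" "i \<in> {1..m}"
  shows "w i * v i \<noteq> 0"
proof -
  have "w i > 0" "v i > 0" using assms unfolding weights_def by blast+
  then show ?thesis by simp
qed

lemma weighted_frame_can_frames:
  assumes "weights w" "weights v" "i \<in> {1..m}"
  shows "weighted_frame w v (can_frames w v F) i l = inv (frame_op F) (F i l)"
  using weights_mult_nonzero[OF assms(1-3)]
  by (simp add: weighted_frame_def can_frames_def flip: of_real_mult)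

text \<open>For fixed weights the rescaling can be undone, so uniqueness of the rescaled vectors
  becomes uniqueness of the local frames.\<close>

lemma can_frames_unique:
  assumes "weights w" "weights v" "i \<in> {1..m}"
    and "weighted_frame w v G i l = inv (frame_op F) (F i l)"
  shows "G i l = can_frames w v F i l"
  using weights_mult_nonzero[OF assms(1-3)]
  by (simp add: can_frames_def weighted_frame_def flip: assms(4) of_real_mult)

lemma dsum_linear_lsynth:
  assumes "fusion_frame_system V v G"
  shows "dsum_linear W V (lsynth G \<circ> lsynth_adj F)"
proof -
  have "lsynth G (lsynth_adj F f) \<in> dsum V" for f
    using assms frame_system_mem[OF assms]
    by (auto simp: dsum_def lsynth_def fusion_frame_system_def fusion_frame_def
        intro!: subspace_sum subspace_scale)
  then show ?thesis
    by (auto simp: dsum_linear_def lsynth_def lsynth_adj_def fun_eq_iff ip_add_left ip_scale_left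
        scale_left_distrib sum.distrib scale_sum_right)
qed

lemma span_scaled_image:
  assumes "c \<noteq> 0"
  shows "span ((\<lambda>a. scale c (f a)) ` A) = span (f ` A)"
proof (rule span_eq[THEN iffD2], intro conjI subsetI)
  fix x assume "x \<in> f ` A"
  then obtain a where a: "a \<in> A" "x = f a" by auto
  then have "x = scale (inverse c) (scale c (f a))" using assms by simp
  then show "x \<in> span ((\<lambda>a. scale c (f a)) ` A)"
    using a(1) by (metis (no_types, lifting) imageI span_base span_scale)
qed (auto intro: span_scale span_base)

text \<open>The inverse frame operator is linear and onto, so it carries spans to spans and the
  whole space to itself; the nonzero factors do not affect the local spans.\<close>

lemma fusion_frame_system_canonical:
  assumes F: "fusion_frame_system W w F" and v: "weights v"
  shows "fusion_frame_system (can_spaces F W) v (can_frames w v F)"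
proof -
  interpret T: Vector_Spaces.linear scale scale "inv (frame_op F)"
    by (rule linear_inv_frame_op[OF F])
  have w: "weights w" and sub: "\<And>i. i \<in> {1..m} \<Longrightarrow> subspace (W i)"
    and spW: "span (\<Union>i\<in>{1..m}. W i) = UNIV"
    and spF: "\<And>i. i \<in> {1..m} \<Longrightarrow> span (F i ` L i) = W i"
    using F by (auto simp: fusion_frame_system_def fusion_frame_def)
  have "(\<Union>i\<in>{1..m}. can_spaces F W i) = inv (frame_op F) ` (\<Union>i\<in>{1..m}. W i)"
    by (auto simp: can_spaces_def)
  then have "span (\<Union>i\<in>{1..m}. can_spaces F W i) = range (inv (frame_op F))"
    by (simp add: T.span_image spW)
  also have "\<dots> = UNIV" using frame_op_inv(2)[OF F] by (metis surj_def)
  finally have sp: "span (\<Union>i\<in>{1..m}. can_spaces F W i) = UNIV" .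
  have "span (can_frames w v F i ` L i) = can_spaces F W i" if i: "i \<in> {1..m}" for i
  proof -
    have "of_real (1 / (w i * v i)) \<noteq> (0::'k)" using weights_mult_nonzero[OF w v i] by simp
    then have "span (can_frames w v F i ` L i) = span (inv (frame_op F) ` F i ` L i)"
      unfolding can_frames_def image_image by (rule span_scaled_image)
    then show ?thesis by (simp add: T.span_image spF[OF i] can_spaces_def)
  qed
  then show ?thesis
    using sp v T.subspace_image[OF sub]
    by (auto simp: fusion_frame_system_def fusion_frame_def can_spaces_def)
qed

text \<open>On component \<open>i\<close> the operator \<open>?Q\<close> is the local frame operator
  of \<open>F i\<close>, followed by the inverse of the global one and division by
  \<open>w i * v i\<close>. The first maps \<open>W i\<close> onto itself, the second maps
  \<open>W i\<close> onto \<open>can_spaces F W i\<close>.\<close>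

lemma cp_dual_system_canonical:
  assumes F: "fusion_frame_system W w F" and v: "weights v"
  shows "cp_dual_system W w F (can_spaces F W) v (can_frames w v F)"
proof -
  let ?V = "can_spaces F W" and ?G = "can_frames w v F"
  let ?Q = "lsynth ?G \<circ> lsynth_adj F"
  interpret T: Vector_Spaces.linear scale scale "inv (frame_op F)"
    by (rule linear_inv_frame_op[OF F])
  have w: "weights w" and W: "fusion_frame W w"
    and spF: "\<And>i. i \<in> {1..m} \<Longrightarrow> span (F i ` L i) = W i"
    using F by (auto simp: fusion_frame_system_def fusion_frame_def)
  note G = fusion_frame_system_canonical[OF F v]
  note lin = dsum_linear_lsynth[OF G, of W F]
  have subV: "subspace (?V i)" if "i \<in> {1..m}" for i
    using G that by (auto simp: fusion_frame_system_def fusion_frame_def)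
  have subW: "subspace (W i)" if "i \<in> {1..m}" for i
    using W that by (auto simp: fusion_frame_def)
  have rec: "synth v (?Q (synth_adj W w x)) = x" for x
    using reconstruction_eq[OF F, of v ?G x] canonical_dual_frame[OF F, of x]
    by (simp add: weighted_frame_can_frames[OF w v])
  have Q: "?Q f i = scale (of_real (1 / (w i * v i)))
      (inv (frame_op F) (\<Sum>l\<in>L i. scale (ip (f i) (F i l)) (F i l)))" if "i \<in> {1..m}" for f i
    using that
    by (simp add: lsynth_def lsynth_adj_def can_frames_def T.sum T.scale scale_sum_right mult.commute)
  have "?Q ` comp_mask j ` dsum W = comp_mask j ` dsum ?V" if j: "j \<in> {1..m}" for j
  proof (intro equalityI subsetI)
    fix g assume "g \<in> ?Q ` comp_mask j ` dsum W"
    then obtain f where f: "f \<in> dsum W" and g: "g = ?Q (comp_mask j f)" by auto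
    have "comp_mask j f \<in> dsum W"
      using f subW by (auto simp: dsum_def comp_mask_def subspace_0)
    then have "g \<in> dsum ?V" using lin g by (simp add: dsum_linear_def)
    \<comment> \<open>Components of the argument that vanish have zero local coefficients, so
      \<open>?Q\<close> sends them to zero.\<close>
    moreover have "comp_mask j g = g"
      by (auto simp: g comp_mask_def lsynth_def lsynth_adj_def fun_eq_iff)
    ultimately show "g \<in> comp_mask j ` dsum ?V" by (metis imageI)
  next
    fix g assume "g \<in> comp_mask j ` dsum ?V"
    then obtain h where h: "h \<in> dsum ?V" and g: "g = comp_mask j h" by auto
    from h j have "h j \<in> ?V j" by (simp add: dsum_def)
    then obtain y where y: "y \<in> W j" "h j = inv (frame_op F) y" by (auto simp: can_spaces_def)
    let ?c = "of_real (w j * v j) :: 'k"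
    have c: "w j * v j \<noteq> 0" by (rule weights_mult_nonzero[OF w v j])
    \<comment> \<open>The factor \<open>?c\<close> compensates the division by the weights in
      \<open>?Q\<close>.\<close>
    have "scale ?c y \<in> span (F j ` L j)" using y(1) by (simp add: spF[OF j] subspace_scale[OF subW[OF j]])
    then obtain x where x: "x \<in> W j" "(\<Sum>l\<in>L j. scale (ip x (F j l)) (F j l)) = scale ?c y"
      using local_frame_op_surj[OF finite_L[OF j], of _ "F j"] spF[OF j] by blast
    define f where "f = (\<lambda>i. if i = j then x else 0)"
    have f: "f \<in> dsum W" "comp_mask j f = f"
      using x(1) j subW by (auto simp: f_def dsum_def comp_mask_def subspace_0)
    have "?Q f = g"
    proof
      fix i
      show "?Q f i = g i"
      proof (cases "i = j")
        case True
        have "?Q f j = h j"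
          unfolding Q[OF j] using c by (simp add: f_def x(2) y(2) T.scale flip: of_real_mult)
        then show ?thesis using True by (simp add: g comp_mask_def)
      next
        case False
        then show ?thesis by (simp add: g comp_mask_def lsynth_def lsynth_adj_def f_def)
      qed
    qed
    then show "g \<in> ?Q ` comp_mask j ` dsum W" using f by (metis imageI)
  qed
  then have "component_preserving W ?V ?Q"
    using lin by (simp add: component_preserving_def)
  moreover have "dual_system W w F ?V v ?G"
    using F G W lin rec by (auto simp: dual_system_def Q_dual_def fusion_frame_system_def)
  ultimately show ?thesis by (simp add: cp_dual_system_def)
qed

section \<open>Loss optimal systems: the first stage and its stability\<close>

lemma loss_optimal_1_iff:
  assumes F: "fusion_frame_system W w F" and norm: "\<forall>i\<in>{1..m}. \<forall>l\<in>L i. hnorm (F i l) = 1"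
    and v0: "weights v0"
  shows "(V, v, G) \<in> loss_optimal 2 W w F 1 \<longleftrightarrow>
    dual_system W w F V v G \<and>
    (\<forall>i\<in>{1..m}. \<forall>l\<in>L i. weighted_frame w v G i l = inv (frame_op F) (F i l))"
proof -
  let ?I = "Sigma {1..m} L"
  let ?c = "\<lambda>i l. inv (frame_op F) (F i l)"
  let ?D = "loss_optimal 2 W w F 0"
  let ?e = "\<lambda>X. pnorm 2 (losses 1) (loss_error W w F X)"
  \<comment> \<open>\<open>C\<close> is the energy of the canonical dual frame, \<open>d\<close> the
    excess of a competitor; by Pythagoras the stage-1 objective is
    \<open>sqrt (C + d v G)\<close>.\<close>
  define C where "C = (\<Sum>(i, l)\<in>?I. (hnorm (?c i l))\<^sup>2)"
  define d where "d v G = (\<Sum>(i, l)\<in>?I. (hnorm (weighted_frame w v G i l - ?c i l))\<^sup>2)" for v G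
  have fin: "finite ?I" using finite_L by auto
  have d0: "0 \<le> d v G" for v G unfolding d_def by (intro sum_nonneg) auto
  \<comment> \<open>Flattens the double sums into one index set, as
    \<open>dual_frame_pythagoras\<close> expects.\<close>
  have sigma: "(\<Sum>i=1..m. \<Sum>l\<in>L i. h i l) = (\<Sum>a\<in>?I. h (fst a) (snd a))" for h :: "nat \<Rightarrow> 'l \<Rightarrow> 'h"
    by (subst sum.Sigma) (use finite_L in \<open>auto simp: case_prod_unfold\<close>)
  have e: "?e (V, v, G) = sqrt (C + d v G)" if "dual_system W w F V v G" for V v G
  proof -
    have "(\<Sum>a\<in>?I. (hnorm (weighted_frame w v G (fst a) (snd a)))\<^sup>2) =
        (\<Sum>a\<in>?I. (hnorm (?c (fst a) (snd a)))\<^sup>2) +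
        (\<Sum>a\<in>?I. (hnorm (weighted_frame w v G (fst a) (snd a) - ?c (fst a) (snd a)))\<^sup>2)"
      using inv_frame_op_self_adjoint[OF F] canonical_dual_frame[OF F]
        dual_system_reconstruction[OF that]
      by (intro dual_frame_pythagoras[where T = "inv (frame_op F)" and f = "\<lambda>a. F (fst a) (snd a)"])
         (simp_all add: sigma)
    then show ?thesis
      by (simp add: pnorm_2_losses_1[OF F norm] C_def d_def case_prod_unfold)
  qed
  \<comment> \<open>A system of excess zero shows that the infimum \<open>sqrt C\<close> is
    attained. \<open>v0\<close> supplies its weights; competitors may carry other weights.\<close>
  let ?X = "(can_spaces F W, v0, can_frames w v0 F)"
  have w: "weights w" using F by (simp add: fusion_frame_system_def fusion_frame_def)
  have X: "?X \<in> ?D"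
    using cp_dual_system_canonical[OF F v0] by (simp add: cp_dual_system_def)
  have "d v0 (can_frames w v0 F) = 0"
    by (auto simp: d_def weighted_frame_can_frames[OF w v0] intro!: sum.neutral)
  then have eX: "?e ?X = sqrt C" using e X by simp
  have "(INF Y\<in>?D. ?e Y) = sqrt C"
  proof (rule cInf_eq_minimum)
    show "sqrt C \<in> ?e ` ?D" using X eX by (metis imageI)
    show "sqrt C \<le> y" if "y \<in> ?e ` ?D" for y
      using that e d0 by auto
  qed
  then have "(V, v, G) \<in> loss_optimal 2 W w F 1 \<longleftrightarrow> dual_system W w F V v G \<and> d v G = 0"
    using e[of V v G] by (auto simp: One_nat_def)
  also have "d v G = 0 \<longleftrightarrow> (\<forall>i\<in>{1..m}. \<forall>l\<in>L i. weighted_frame w v G i l = ?c i l)"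
    unfolding d_def by (subst sum_nonneg_eq_0_iff[OF fin]) auto
  finally show ?thesis .
qed

text \<open>Every later objective is constant on stage \<open>r\<close>, since the whole error
  functions agree there; each member then attains the infimum and none is discarded.\<close>

lemma loss_optimal_stationary:
  assumes const: "\<And>X Y. X \<in> loss_optimal p W w F r \<Longrightarrow> Y \<in> loss_optimal p W w F r \<Longrightarrow>
      loss_error W w F X = loss_error W w F Y"
    and "r \<le> s"
  shows "loss_optimal p W w F s = loss_optimal p W w F r"
  using \<open>r \<le> s\<close>
proof (induction s rule: dec_induct)
  case (step s)
  have "(INF Y\<in>loss_optimal p W w F r. pnorm p (losses (Suc s)) (loss_error W w F Y)) =
      pnorm p (losses (Suc s)) (loss_error W w F X)" if X: "X \<in> loss_optimal p W w F r" for X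
  proof -
    \<comment> \<open>The infimum is taken over a singleton set of values.\<close>
    have "(\<lambda>Y. pnorm p (losses (Suc s)) (loss_error W w F Y)) ` loss_optimal p W w F r =
        {pnorm p (losses (Suc s)) (loss_error W w F X)}"
      using X const[OF X] by force
    then show ?thesis by simp
  qed
  then show ?case by (auto simp: step.IH)
qed simp

lemma loss_optimal_iff:
  assumes F: "fusion_frame_system W w F" and norm: "\<forall>i\<in>{1..m}. \<forall>l\<in>L i. hnorm (F i l) = 1"
    and v0: "weights v0" and r: "1 \<le> r"
  shows "(V, v, G) \<in> loss_optimal 2 W w F r \<longleftrightarrow>
    dual_system W w F V v G \<and>
    (\<forall>i\<in>{1..m}. \<forall>l\<in>L i. weighted_frame w v G i l = inv (frame_op F) (F i l))"
proof -
  have "loss_optimal 2 W w F r = loss_optimal 2 W w F 1"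
  proof (rule loss_optimal_stationary[OF _ r])
    fix X Y assume XY: "X \<in> loss_optimal 2 W w F 1" "Y \<in> loss_optimal 2 W w F 1"
    obtain V v G V' v' G' where "X = (V, v, G)" "Y = (V', v', G')" by (metis prod_cases3)
    with XY show "loss_error W w F X = loss_error W w F Y"
      by (auto simp only: loss_optimal_1_iff[OF F norm v0] intro!: loss_error_cong[OF F])
  qed
  then show ?thesis by (simp only: loss_optimal_1_iff[OF F norm v0])
qed

lemma loss_optimal_frames:
  assumes F: "fusion_frame_system W w F" and norm: "\<forall>i\<in>{1..m}. \<forall>l\<in>L i. hnorm (F i l) = 1"
    and v: "weights v" and r: "1 \<le> r"
    and opt: "(V, v, G) \<in> loss_optimal 2 W w F r"
    and il: "i \<in> {1..m}" "l \<in> L i"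
  shows "G i l = can_frames w v F i l"
proof (rule can_frames_unique[OF _ v il(1)])
  show "weights w" using F by (simp add: fusion_frame_system_def fusion_frame_def)
  show "weighted_frame w v G i l = inv (frame_op F) (F i l)"
    using opt il by (simp add: loss_optimal_iff[OF F norm v r])
qed

end

theorem theorem5p6:
  fixes scale :: "'k::real_or_complex \<Rightarrow> 'h::ab_group_add \<Rightarrow> 'h"
    and ip :: "'h \<Rightarrow> 'h \<Rightarrow> 'k"
    and m :: nat
    and L :: "nat \<Rightarrow> 'l set"
    and W :: "nat \<Rightarrow> 'h set"
    and w v :: "nat \<Rightarrow> real"
    and F :: "nat \<Rightarrow> 'l \<Rightarrow> 'h"
    and r :: nat
  assumes "fusion scale ip m L"
    and "fusion.fusion_frame_system scale m L W w F"
    and "\<forall>i\<in>{1..m}. \<forall>l\<in>L i. fd_hilbert.hnorm ip (F i l) = 1"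
    and "fusion.weights m v"
    and "r \<in> {1..(\<Sum>i=1..m. card (L i))}"
  shows "let D = fusion.loss_optimal scale ip m L 2 W w F r;
      cp_dual = fusion.cp_dual_system scale ip m L W w F;
      Wc = fusion.can_spaces scale ip m L F W;
      Gc = fusion.can_frames scale ip m L w v F
    in
      ((Wc, v, Gc) \<in> D \<and> cp_dual Wc v Gc) \<and>
      (\<forall>V G. (V, v, G) \<in> D \<longrightarrow>
        (\<forall>x \<in> fusion.coeffs m L.
          fusion.synth scale m v (fusion.lsynth scale m L G x) =
          fusion.synth scale m v (fusion.lsynth scale m L Gc x))) \<and>
      (\<forall>V G. (V, v, G) \<in> D \<and> cp_dual V v G \<longrightarrow>
        (\<forall>i\<in>{1..m}. V i = Wc i \<and> (\<forall>l\<in>L i. G i l = Gc i l)))"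
proof -
  interpret fusion scale ip m L by (rule assms(1))
  note F = assms(2) and norm = assms(3) and v = assms(4)
  let ?Wc = "can_spaces F W" and ?Gc = "can_frames w v F"
  have r: "1 \<le> r" using assms(5) by simp
  have w: "weights w" using F by (simp add: fusion_frame_system_def fusion_frame_def)
  note can = cp_dual_system_canonical[OF F v]
  have "(?Wc, v, ?Gc) \<in> loss_optimal 2 W w F r"
    using can by (simp add: loss_optimal_iff[OF F norm v r] cp_dual_system_def
        weighted_frame_can_frames[OF w v])
  moreover have "synth v (lsynth G x) = synth v (lsynth ?Gc x)"
    if opt: "(V, v, G) \<in> loss_optimal 2 W w F r" for V G x
  proof -
    \<comment> \<open>\<open>lsynth\<close> reads the local frames only at the indices where they
      agree.\<close>
    have "lsynth G x = lsynth ?Gc x"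
    proof
      fix i
      have "(\<Sum>l\<in>L i. scale (x i l) (G i l)) = (\<Sum>l\<in>L i. scale (x i l) (?Gc i l))"
        if i: "i \<in> {1..m}"
      proof (rule sum.cong[OF refl])
        fix l assume "l \<in> L i"
        then show "scale (x i l) (G i l) = scale (x i l) (?Gc i l)"
          by (simp only: loss_optimal_frames[OF F norm v r opt i])
      qed
      then show "lsynth G x i = lsynth ?Gc x i" unfolding lsynth_def by auto
    qed
    then show ?thesis by simp
  qed
  moreover have "V i = ?Wc i" if "(V, v, G) \<in> loss_optimal 2 W w F r" and i: "i \<in> {1..m}" for V G i
  proof -
    have "dual_system W w F V v G" using that(1) loss_optimal_iff[OF F norm v r] by simp
    \<comment> \<open>A local frame spans its space, so the spaces are determined by the local
      frames.\<close>
    then have "V i = span (G i ` L i)"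
      using i by (auto simp: dual_system_def fusion_frame_system_def)
    also have "G i ` L i = ?Gc i ` L i"
      using loss_optimal_frames[OF F norm v r that] by (intro image_cong) auto
    also have "span \<dots> = ?Wc i"
      using fusion_frame_system_canonical[OF F v] i by (simp add: fusion_frame_system_def)
    finally show ?thesis .
  qed
  ultimately show ?thesis
    unfolding Let_def using can loss_optimal_frames[OF F norm v r] by blast
qed

end
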